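(* Let $(G,E)$ be a self-similar groupoid action. The condition (Evr) if $g\in G$ fixes every path in $s(g)E^*$, then $g$ strongly fixes some path in $s(g)E^*$; is equivalent to each of the following: (1) the inverse semigroup $S(G,E)$ is quasi-fundamental; (2) the inverse semigroup $S_0(G,E)$ is topologically free; (3) the inverse semigroup $S_{00}(G,E)$ is topologically free. The inverse semigroup $S(G,E)$ is fundamental if and only if the self-similar action is faithful.
   Context: A directed graph $E=(E^0,E^1,r,s)$ has vertices $E^0$, edges $E^1$, and maps $r,s:E^1\to E^0$. For $n\ge1$, $E^n$ is the set of paths $\mu=\mu_1\cdots\mu_n$ ($\mu_i\in E^1$, $s(\mu_i)=r(\mu_{i+1})$), $r(\mu)=r(\mu_1)$, $s(\mu)=s(\mu_n)$, $|\mu|=n$; vertices are paths of length $0$ with $r(v)=s(v)=v$; $E^*=\bigcup_{n\ge0}E^n$; $vE^*$ denotes paths with range $v$. $(G,E)$ is a self-similar action if $G$ is a discrete groupoid with $G^0=E^0$, equipped with a left action $(g,e)\mapsto ge$ on $E^1$ (defined when $s(g)=r(e)$, with $r(ge)=r(g)$, $(hg)e=h(ge)$, $r(e)e=e$) and a map $(g,e)\mapsto g|_e\in G$ with $(hg)|_e=h|_{ge}\,g|_e$, $s(g|_e)=s(e)$, $r(g|_e)=s(ge)$. It extends to paths by $g\,s(g)=r(g)$, $g|_{s(g)}=g$, $g(e\mu)=(ge)(g|_e\mu)$, $g|_{e\mu}=(g|_e)|_\mu$. $g$ fixes $\mu$ if $g\mu=\mu$, and strongly fixes $\mu\in s(g)E^*$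 if $g\mu=\mu$ and $g|_\mu=s(\mu)$. The action is faithful if $g\mu=\mu$ for all $\mu\in s(g)E^*$ implies $g\in G^0$. $S(G,E)=\{(\alpha,g,\beta):\alpha,\beta\in E^*,g\in G,r(g)=s(\alpha),s(g)=s(\beta)\}\cup\{0\}$ with $(\alpha,g,\beta)(\gamma,h,\delta)=(\alpha(g\beta'),g|_{\beta'}h,\delta)$ if $\gamma=\beta\beta'$, $=(\alpha,g(h^{-1}|_{\gamma'})^{-1},\delta(h^{-1}\gamma'))$ if $\beta=\gamma\gamma'$, $=0$ otherwise, and $(\alpha,g,\beta)^*=(\beta,g^{-1},\alpha)$; its nonzero idempotents are $(\alpha,s(\alpha),\alpha)$, $\alpha\in E^*$. $S_0(G,E)=\{(\alpha,g,\beta):|\alpha|=|\beta|\}\cup\{0\}$ and $S_{00}(G,E)=\{(g\beta,g|_\beta,\beta):s(g)=r(\beta)\}\cup\{0\}$ are inverse subsemigroups containing all idempotents. Let $S$ be an inverse semigroup with zero, with idempotents $\mathcal E$ and order $t\le u\iff t=ut^*t$. An idempotent $e$ is fixed by $t\in S$ if $(tft^* )f\ne0$ for every nonzero idempotent $f\le e$. $S$ is topologically free if for every $t\in S$ and every nonzero $e\in\mathcal E$ fixed by $t$ there is a nonzero idempotent $f\le t$ with $fe\neq0$. $S$ is fundamental if $ses^*=tet^*$ for all $e\in\mathcal E$ implies $s=t$; $S$ is quasi-fundamental if for all $s,t\in S\setminus\{0\}$ with $ses^*=tet^*$ for all $e\in\mathcal E$ there is $u\in S\setminus\{0\}$ with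 $u\le s,t$. *)

theory Defs
  imports "Graph_Theory.Digraph" "HOL-Library.Sublist"
begin

section \<open>Inverse semigroups with zero\<close>

record 's inv_semigroup =
  carrier :: "'s set"
  mult :: "'s \<Rightarrow> 's \<Rightarrow> 's" (infixl "\<otimes>\<index>" 70)
  star :: "'s \<Rightarrow> 's"
  zero :: 's

definition idempotents :: "('s, 'x) inv_semigroup_scheme \<Rightarrow> 's set" where
  "idempotents S = {e \<in> carrier S. e \<otimes>\<^bsub>S\<^esub> e = e}"

definition below :: "('s, 'x) inv_semigroup_scheme \<Rightarrow> 's \<Rightarrow> 's \<Rightarrow> bool" where
  "below S t u \<longleftrightarrow> t = u \<otimes>\<^bsub>S\<^esub> star S t \<otimes>\<^bsub>S\<^esub> t"

definition idempotent_fixed_by :: "('s, 'x) inv_semigroup_scheme \<Rightarrow> 's \<Rightarrow> 's \<Rightarrow> bool" where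
  "idempotent_fixed_by S e t \<longleftrightarrow>
     (\<forall>f \<in> idempotents S. f \<noteq> zero S \<and> below S f e \<longrightarrow>
        (t \<otimes>\<^bsub>S\<^esub> f \<otimes>\<^bsub>S\<^esub> star S t) \<otimes>\<^bsub>S\<^esub> f \<noteq> zero S)"

definition topologically_free :: "('s, 'x) inv_semigroup_scheme \<Rightarrow> bool" where
  "topologically_free S \<longleftrightarrow>
     (\<forall>t \<in> carrier S. \<forall>e \<in> idempotents S. e \<noteq> zero S \<and> idempotent_fixed_by S e t \<longrightarrow>
        (\<exists>f \<in> idempotents S. f \<noteq> zero S \<and> below S f t \<and> f \<otimes>\<^bsub>S\<^esub> e \<noteq> zero S))"

definition same_conjugation :: "('s, 'x) inv_semigroup_scheme \<Rightarrow> 's \<Rightarrow> 's \<Rightarrow> bool" where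
  "same_conjugation S s t \<longleftrightarrow>
     (\<forall>e \<in> idempotents S.
        s \<otimes>\<^bsub>S\<^esub> e \<otimes>\<^bsub>S\<^esub> star S s = t \<otimes>\<^bsub>S\<^esub> e \<otimes>\<^bsub>S\<^esub> star S t)"

definition fundamental :: "('s, 'x) inv_semigroup_scheme \<Rightarrow> bool" where
  "fundamental S \<longleftrightarrow>
     (\<forall>s \<in> carrier S. \<forall>t \<in> carrier S. same_conjugation S s t \<longrightarrow> s = t)"

definition quasi_fundamental :: "('s, 'x) inv_semigroup_scheme \<Rightarrow> bool" where
  "quasi_fundamental S \<longleftrightarrow>
     (\<forall>s \<in> carrier S - {zero S}. \<forall>t \<in> carrier S - {zero S}. same_conjugation S s t \<longrightarrow>
        (\<exists>u \<in> carrier S - {zero S}. below S u s \<and> below S u t))"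

section \<open>Groupoids\<close>

text \<open>Groupoids are arrows-only: the unit space consists of the arrows that are ranges
  (equivalently sources) of arrows. The operations are only constrained on arrows, and the
  product \<open>comp \<Gamma> h g\<close> only where \<open>src \<Gamma> h = rng \<Gamma> g\<close>.\<close>

record 'g groupoid_data =
  arrows :: "'g set"
  comp :: "'g \<Rightarrow> 'g \<Rightarrow> 'g" (infixl "\<bullet>\<index>" 70)
  ginv :: "'g \<Rightarrow> 'g"
  rng :: "'g \<Rightarrow> 'g"
  src :: "'g \<Rightarrow> 'g"

definition units :: "('g, 'x) groupoid_data_scheme \<Rightarrow> 'g set" where
  "units \<Gamma> = rng \<Gamma> ` arrows \<Gamma>"

locale groupoid =
  fixes \<Gamma> :: "'g groupoid_data" (structure)
  assumes rng_closed: "g \<in> arrows \<Gamma> \<Longrightarrow> rng \<Gamma> g \<in> arrows \<Gamma>"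
    and src_closed: "g \<in> arrows \<Gamma> \<Longrightarrow> src \<Gamma> g \<in> arrows \<Gamma>"
    and rng_rng: "g \<in> arrows \<Gamma> \<Longrightarrow> rng \<Gamma> (rng \<Gamma> g) = rng \<Gamma> g"
    and src_rng: "g \<in> arrows \<Gamma> \<Longrightarrow> src \<Gamma> (rng \<Gamma> g) = rng \<Gamma> g"
    and rng_src: "g \<in> arrows \<Gamma> \<Longrightarrow> rng \<Gamma> (src \<Gamma> g) = src \<Gamma> g"
    and src_src: "g \<in> arrows \<Gamma> \<Longrightarrow> src \<Gamma> (src \<Gamma> g) = src \<Gamma> g"
    and comp_closed: "\<lbrakk>h \<in> arrows \<Gamma>; g \<in> arrows \<Gamma>; src \<Gamma> h = rng \<Gamma> g\<rbrakk> \<Longrightarrow> h \<bullet> g \<in> arrows \<Gamma>"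
    and rng_comp: "\<lbrakk>h \<in> arrows \<Gamma>; g \<in> arrows \<Gamma>; src \<Gamma> h = rng \<Gamma> g\<rbrakk> \<Longrightarrow> rng \<Gamma> (h \<bullet> g) = rng \<Gamma> h"
    and src_comp: "\<lbrakk>h \<in> arrows \<Gamma>; g \<in> arrows \<Gamma>; src \<Gamma> h = rng \<Gamma> g\<rbrakk> \<Longrightarrow> src \<Gamma> (h \<bullet> g) = src \<Gamma> g"
    and comp_assoc: "\<lbrakk>k \<in> arrows \<Gamma>; h \<in> arrows \<Gamma>; g \<in> arrows \<Gamma>; src \<Gamma> k = rng \<Gamma> h; src \<Gamma> h = rng \<Gamma> g\<rbrakk>
          \<Longrightarrow> (k \<bullet> h) \<bullet> g = k \<bullet> (h \<bullet> g)"
    and rng_left_unit: "g \<in> arrows \<Gamma> \<Longrightarrow> rng \<Gamma> g \<bullet> g = g"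
    and src_right_unit: "g \<in> arrows \<Gamma> \<Longrightarrow> g \<bullet> src \<Gamma> g = g"
    and inv_closed: "g \<in> arrows \<Gamma> \<Longrightarrow> ginv \<Gamma> g \<in> arrows \<Gamma>"
    and rng_inv: "g \<in> arrows \<Gamma> \<Longrightarrow> rng \<Gamma> (ginv \<Gamma> g) = src \<Gamma> g"
    and src_inv: "g \<in> arrows \<Gamma> \<Longrightarrow> src \<Gamma> (ginv \<Gamma> g) = rng \<Gamma> g"
    and left_inv: "g \<in> arrows \<Gamma> \<Longrightarrow> ginv \<Gamma> g \<bullet> g = src \<Gamma> g"
    and right_inv: "g \<in> arrows \<Gamma> \<Longrightarrow> g \<bullet> ginv \<Gamma> g = rng \<Gamma> g"

section \<open>Paths in a directed graph\<close>

text \<open>An edge \<open>e\<close> has source \<open>s(e) = tail E e\<close> and range \<open>r(e) = head E e\<close>. In a path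
  \<open>\<mu>\<^sub>1 \<dots> \<mu>\<^sub>n\<close> consecutive edges satisfy \<open>s(\<mu>\<^sub>i) = r(\<mu>\<^sub>i\<^sub>+\<^sub>1)\<close>, so these are the reversals of
  the walks of the graph library. A path is encoded as the pair of its range vertex and its
  list of edges; the vertex \<open>v\<close>, as a path of length \<open>0\<close>, is \<open>(v, [])\<close>.\<close>

type_synonym ('v, 'e) gpath = "'v \<times> 'e list"

definition paths :: "('v, 'e) pre_digraph \<Rightarrow> ('v, 'e) gpath set" where
  "paths E = {(v, es). v \<in> verts E \<and> set es \<subseteq> arcs E \<and>
     (es \<noteq> [] \<longrightarrow> head E (hd es) = v) \<and>
     successively (\<lambda>e f. tail E e = head E f) es}"

definition path_rng :: "('v, 'e) gpath \<Rightarrow> 'v" where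
  "path_rng \<mu> = fst \<mu>"

definition path_src :: "('v, 'e) pre_digraph \<Rightarrow> ('v, 'e) gpath \<Rightarrow> 'v" where
  "path_src E \<mu> = (if snd \<mu> = [] then fst \<mu> else tail E (last (snd \<mu>)))"

definition path_length :: "('v, 'e) gpath \<Rightarrow> nat" where
  "path_length \<mu> = length (snd \<mu>)"

definition path_append :: "('v, 'e) gpath \<Rightarrow> ('v, 'e) gpath \<Rightarrow> ('v, 'e) gpath" where
  "path_append \<mu> \<nu> = (fst \<mu>, snd \<mu> @ snd \<nu>)"

definition path_prefix :: "('v, 'e) gpath \<Rightarrow> ('v, 'e) gpath \<Rightarrow> bool" where
  "path_prefix \<mu> \<nu> \<longleftrightarrow> fst \<mu> = fst \<nu> \<and> prefix (snd \<mu>) (snd \<nu>)"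

text \<open>If \<open>\<nu> = \<mu>\<nu>'\<close> then \<open>path_rest E \<mu> \<nu>\<close> is the path \<open>\<nu>'\<close>, whose range is the source of \<open>\<mu>\<close>.\<close>

definition path_rest :: "('v, 'e) pre_digraph \<Rightarrow> ('v, 'e) gpath \<Rightarrow> ('v, 'e) gpath \<Rightarrow> ('v, 'e) gpath" where
  "path_rest E \<mu> \<nu> = (path_src E \<mu>, drop (length (snd \<mu>)) (snd \<nu>))"

section \<open>Self-similar actions\<close>

locale self_similar_action = groupoid \<Gamma> + wf_digraph E
  for \<Gamma> :: "'g groupoid_data" (structure) and E :: "('g, 'e) pre_digraph" +
  fixes act :: "'g \<Rightarrow> 'e \<Rightarrow> 'e" and res :: "'g \<Rightarrow> 'e \<Rightarrow> 'g"
  assumes units_eq_verts: "units \<Gamma> = verts E"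
    and act_closed: "\<lbrakk>g \<in> arrows \<Gamma>; e \<in> arcs E; src \<Gamma> g = head E e\<rbrakk> \<Longrightarrow> act g e \<in> arcs E"
    and head_act: "\<lbrakk>g \<in> arrows \<Gamma>; e \<in> arcs E; src \<Gamma> g = head E e\<rbrakk> \<Longrightarrow> head E (act g e) = rng \<Gamma> g"
    and act_comp: "\<lbrakk>h \<in> arrows \<Gamma>; g \<in> arrows \<Gamma>; e \<in> arcs E; src \<Gamma> h = rng \<Gamma> g; src \<Gamma> g = head E e\<rbrakk>
          \<Longrightarrow> act (h \<bullet> g) e = act h (act g e)"
    and act_unit: "e \<in> arcs E \<Longrightarrow> act (head E e) e = e"
    and res_closed: "\<lbrakk>g \<in> arrows \<Gamma>; e \<in> arcs E; src \<Gamma> g = head E e\<rbrakk> \<Longrightarrow> res g e \<in> arrows \<Gamma>"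
    and res_comp: "\<lbrakk>h \<in> arrows \<Gamma>; g \<in> arrows \<Gamma>; e \<in> arcs E; src \<Gamma> h = rng \<Gamma> g; src \<Gamma> g = head E e\<rbrakk>
          \<Longrightarrow> res (h \<bullet> g) e = res h (act g e) \<bullet> res g e"
    and src_res: "\<lbrakk>g \<in> arrows \<Gamma>; e \<in> arcs E; src \<Gamma> g = head E e\<rbrakk> \<Longrightarrow> src \<Gamma> (res g e) = tail E e"
    and rng_res: "\<lbrakk>g \<in> arrows \<Gamma>; e \<in> arcs E; src \<Gamma> g = head E e\<rbrakk>
          \<Longrightarrow> rng \<Gamma> (res g e) = tail E (act g e)"
begin

primrec act_edges :: "'g \<Rightarrow> 'e list \<Rightarrow> 'e list" where
  "act_edges g [] = []"
| "act_edges g (e # es) = act g e # act_edges (res g e) es"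

primrec res_edges :: "'g \<Rightarrow> 'e list \<Rightarrow> 'g" where
  "res_edges g [] = g"
| "res_edges g (e # es) = res_edges (res g e) es"

text \<open>The range of \<open>g\<mu>\<close> is \<open>r(g)\<close>, also for a path \<open>\<mu> = s(g)\<close> of length \<open>0\<close>.\<close>

definition path_act :: "'g \<Rightarrow> ('g, 'e) gpath \<Rightarrow> ('g, 'e) gpath" where
  "path_act g \<mu> = (rng \<Gamma> g, act_edges g (snd \<mu>))"

definition path_res :: "'g \<Rightarrow> ('g, 'e) gpath \<Rightarrow> 'g" where
  "path_res g \<mu> = res_edges g (snd \<mu>)"

definition fixes_path :: "'g \<Rightarrow> ('g, 'e) gpath \<Rightarrow> bool" where
  "fixes_path g \<mu> \<longleftrightarrow> path_act g \<mu> = \<mu>"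

definition strongly_fixes_path :: "'g \<Rightarrow> ('g, 'e) gpath \<Rightarrow> bool" where
  "strongly_fixes_path g \<mu> \<longleftrightarrow> path_act g \<mu> = \<mu> \<and> path_res g \<mu> = path_src E \<mu>"

definition paths_with_range :: "'g \<Rightarrow> ('g, 'e) gpath set" where
  "paths_with_range v = {\<mu> \<in> paths E. path_rng \<mu> = v}"

definition faithful :: bool where
  "faithful \<longleftrightarrow>
     (\<forall>g \<in> arrows \<Gamma>. (\<forall>\<mu> \<in> paths_with_range (src \<Gamma> g). fixes_path g \<mu>) \<longrightarrow> g \<in> units \<Gamma>)"

definition Evr :: bool where
  "Evr \<longleftrightarrow>
     (\<forall>g \<in> arrows \<Gamma>. (\<forall>\<mu> \<in> paths_with_range (src \<Gamma> g). fixes_path g \<mu>) \<longrightarrow>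
        (\<exists>\<mu> \<in> paths_with_range (src \<Gamma> g). strongly_fixes_path g \<mu>))"

text \<open>The zero element of the semigroups below is \<open>None\<close>.\<close>

fun ss_mult :: "(('g, 'e) gpath \<times> 'g \<times> ('g, 'e) gpath) option \<Rightarrow>
    (('g, 'e) gpath \<times> 'g \<times> ('g, 'e) gpath) option \<Rightarrow>
    (('g, 'e) gpath \<times> 'g \<times> ('g, 'e) gpath) option" where
  "ss_mult (Some (\<alpha>, g, \<beta>)) (Some (\<gamma>, h, \<delta>)) =
     (if path_prefix \<beta> \<gamma> then
        let \<beta>' = path_rest E \<beta> \<gamma>
        in Some (path_append \<alpha> (path_act g \<beta>'), path_res g \<beta>' \<bullet> h, \<delta>)
      else if path_prefix \<gamma> \<beta> then
        let \<gamma>' = path_rest E \<gamma> \<beta>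
        in Some (\<alpha>, g \<bullet> ginv \<Gamma> (path_res (ginv \<Gamma> h) \<gamma>'),
                 path_append \<delta> (path_act (ginv \<Gamma> h) \<gamma>'))
      else None)"
| "ss_mult None _ = None"
| "ss_mult _ None = None"

fun ss_star :: "(('g, 'e) gpath \<times> 'g \<times> ('g, 'e) gpath) option \<Rightarrow>
    (('g, 'e) gpath \<times> 'g \<times> ('g, 'e) gpath) option" where
  "ss_star (Some (\<alpha>, g, \<beta>)) = Some (\<beta>, ginv \<Gamma> g, \<alpha>)"
| "ss_star None = None"

definition S_GE :: "(('g, 'e) gpath \<times> 'g \<times> ('g, 'e) gpath) option inv_semigroup" where
  "S_GE = \<lparr> carrier =
       {Some (\<alpha>, g, \<beta>) | \<alpha> g \<beta>. \<alpha> \<in> paths E \<and> \<beta> \<in> paths E \<and> g \<in> arrows \<Gamma> \<and>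
          rng \<Gamma> g = path_src E \<alpha> \<and> src \<Gamma> g = path_src E \<beta>} \<union> {None},
     mult = ss_mult, star = ss_star, zero = None \<rparr>"

definition S0_GE :: "(('g, 'e) gpath \<times> 'g \<times> ('g, 'e) gpath) option inv_semigroup" where
  "S0_GE = S_GE \<lparr> carrier :=
       {Some (\<alpha>, g, \<beta>) | \<alpha> g \<beta>. Some (\<alpha>, g, \<beta>) \<in> carrier S_GE \<and>
          path_length \<alpha> = path_length \<beta>} \<union> {None} \<rparr>"

definition S00_GE :: "(('g, 'e) gpath \<times> 'g \<times> ('g, 'e) gpath) option inv_semigroup" where
  "S00_GE = S_GE \<lparr> carrier :=
       {Some (path_act g \<beta>, path_res g \<beta>, \<beta>) | g \<beta>. g \<in> arrows \<Gamma> \<and> \<beta> \<in> paths E \<and>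
          src \<Gamma> g = path_rng \<beta>} \<union> {None} \<rparr>"

end

end

theory Submission
  imports Defs
begin

text \<open>Write \<open>e\<^sub>\<mu> = (\<mu>, s(\<mu>), \<mu>)\<close>. Conjugation by \<open>t = (\<alpha>, g, \<beta>)\<close> sends \<open>e\<close> of \<open>\<beta>\<mu>\<close> to \<open>e\<close> of
  \<open>\<alpha>(g\<mu>)\<close>. Hence two nonzero elements with the same conjugation are \<open>(\<alpha>, g, \<beta>)\<close> and \<open>(\<alpha>, h, \<beta>)\<close> with
  \<open>h\<^sup>-\<^sup>1g\<close> fixing all paths, and they have a common nonzero lower bound iff \<open>h\<^sup>-\<^sup>1g\<close> strongly fixes some
  path. If \<open>|\<alpha>| = |\<beta>|\<close>, then \<open>t\<close> can fix \<open>e\<^sub>\<gamma>\<close> only if \<open>\<alpha> = \<beta>\<close> and, after lengthening \<open>\<gamma>\<close> so that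
  \<open>\<gamma> = \<beta>\<beta>'\<close>, the restriction of \<open>g\<close> to \<open>\<beta>'\<close> fixes all paths; an idempotent below \<open>t\<close> then arises from a
  strongly fixed path. Conversely \<open>(r(g), g, s(g))\<close> tests each condition on a given \<open>g\<close>.\<close>

section \<open>Inverses and units in a groupoid\<close>

context groupoid
begin

lemma ginv_ginv:
  assumes "g \<in> arrows \<Gamma>" shows "ginv \<Gamma> (ginv \<Gamma> g) = g"
proof -
  let ?i = "ginv \<Gamma> g" let ?j = "ginv \<Gamma> (ginv \<Gamma> g)"
  have "?j = ?j \<bullet> (?i \<bullet> g)"
    using assms src_right_unit[of ?j] by (simp add: left_inv src_inv rng_inv inv_closed)
  also have "\<dots> = (?j \<bullet> ?i) \<bullet> g"
    using assms by (simp add: comp_assoc src_inv rng_inv inv_closed)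
  also have "\<dots> = g"
    using assms by (simp add: left_inv inv_closed src_inv rng_left_unit)
  finally show ?thesis .
qed

lemma ginv_unique:
  assumes "h \<in> arrows \<Gamma>" "g \<in> arrows \<Gamma>" "src \<Gamma> h = rng \<Gamma> g" "h \<bullet> g = src \<Gamma> g"
  shows "h = ginv \<Gamma> g"
proof -
  have "h = h \<bullet> (g \<bullet> ginv \<Gamma> g)"
    using assms src_right_unit[of h] by (simp add: right_inv)
  also have "\<dots> = (h \<bullet> g) \<bullet> ginv \<Gamma> g"
    using assms comp_assoc[of h g "ginv \<Gamma> g"] by (simp add: rng_inv inv_closed)
  also have "\<dots> = ginv \<Gamma> g"
    using assms rng_left_unit[of "ginv \<Gamma> g"] by (simp add: rng_inv inv_closed)
  finally show ?thesis .
qed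

text \<open>Multiplying \<open>g \<bullet> g = g\<close> by the inverse cancels one factor. This
  identifies restrictions of units (\<open>res_unit\<close>) and the middle entries of idempotent
  triples (\<open>idempotents_S_GE\<close>).\<close>

lemma idempotent_arrow:
  assumes "g \<in> arrows \<Gamma>" "src \<Gamma> g = rng \<Gamma> g" "g \<bullet> g = g"
  shows "g = src \<Gamma> g"
proof -
  have "g = (ginv \<Gamma> g \<bullet> g) \<bullet> g"
    using assms rng_left_unit[of g] by (simp add: left_inv)
  also have "\<dots> = src \<Gamma> g"
    using assms by (subst comp_assoc) (simp_all add: left_inv inv_closed src_inv rng_inv)
  finally show ?thesis .
qed

lemma mem_units:
  assumes "v \<in> units \<Gamma>"
  shows "v \<in> arrows \<Gamma>" "rng \<Gamma> v = v" "src \<Gamma> v = v"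
  using assms by (auto simp: units_def rng_closed rng_rng src_rng)

lemma units_iff: "v \<in> units \<Gamma> \<longleftrightarrow> v \<in> arrows \<Gamma> \<and> src \<Gamma> v = v"
  by (metis imageI mem_units(1,3) rng_src src_closed units_def)

lemma src_in_units: "g \<in> arrows \<Gamma> \<Longrightarrow> src \<Gamma> g \<in> units \<Gamma>"
  by (simp add: units_iff src_closed src_src)

lemma rng_in_units: "g \<in> arrows \<Gamma> \<Longrightarrow> rng \<Gamma> g \<in> units \<Gamma>"
  by (simp add: units_def)

lemma ginv_unit: "v \<in> units \<Gamma> \<Longrightarrow> ginv \<Gamma> v = v"
  by (metis ginv_unique mem_units rng_left_unit)

end

section \<open>Concatenation, prefixes and remainders of paths\<close>

lemma paths_Nil [simp]: "(v, []) \<in> paths E \<longleftrightarrow> v \<in> verts E"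
  by (simp add: paths_def)

text \<open>Peeling off the edge at the range end moves the base vertex to \<open>tail G e\<close>;
  inductions on edge lists therefore let the vertex or the arrow vary.\<close>

lemma (in wf_digraph) paths_Cons [simp]:
  "(v, e # es) \<in> paths G \<longleftrightarrow> e \<in> arcs G \<and> v = head G e \<and> (tail G e, es) \<in> paths G"
  by (cases es) (auto simp: paths_def)

lemma path_src_Nil [simp]: "path_src E (v, []) = v"
  by (simp add: path_src_def)

lemma path_src_Cons [simp]: "path_src E (v, e # es) = path_src E (tail E e, es)"
  by (simp add: path_src_def)

lemma path_rng_append [simp]: "path_rng (path_append \<mu> \<nu>) = path_rng \<mu>"
  by (simp add: path_append_def path_rng_def)

lemma path_length_append [simp]:
  "path_length (path_append \<mu> \<nu>) = path_length \<mu> + path_length \<nu>"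
  by (simp add: path_append_def path_length_def)

lemma path_append_assoc: "path_append (path_append \<kappa> \<mu>) \<nu> = path_append \<kappa> (path_append \<mu> \<nu>)"
  by (simp add: path_append_def)

lemma path_append_Nil [simp]: "path_append \<mu> (v, []) = \<mu>"
  by (simp add: path_append_def)

lemma path_Nil_append: "path_rng \<mu> = v \<Longrightarrow> path_append (v, []) \<mu> = \<mu>"
  by (auto simp: path_append_def path_rng_def)

lemma path_src_append [simp]:
  "path_rng \<nu> = path_src E \<mu> \<Longrightarrow> path_src E (path_append \<mu> \<nu>) = path_src E \<nu>"
  by (auto simp: path_append_def path_rng_def path_src_def)

text \<open>\<open>path_append\<close> discards the range vertex of its second argument, so
  cancellation recovers only the edge list; the hypothesis on ranges supplies the vertex.\<close>

lemma path_append_cancel: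
  "\<lbrakk>path_append \<kappa> \<mu> = path_append \<kappa> \<nu>; path_rng \<mu> = path_rng \<nu>\<rbrakk> \<Longrightarrow> \<mu> = \<nu>"
  by (auto simp: path_append_def path_rng_def prod_eq_iff)

lemma path_prefix_append [simp]: "path_prefix \<mu> (path_append \<mu> \<nu>)"
  by (simp add: path_append_def path_prefix_def)

lemma path_prefix_refl [simp]: "path_prefix \<mu> \<mu>"
  by (simp add: path_prefix_def)

lemma path_prefix_Nil: "path_prefix (v, []) \<mu> \<longleftrightarrow> path_rng \<mu> = v"
  by (auto simp: path_prefix_def path_rng_def)

lemma path_prefix_into_Nil: "path_prefix \<mu> (v, []) \<longleftrightarrow> \<mu> = (v, [])"
  by (auto simp: path_prefix_def prod_eq_iff)

text \<open>A proper prefix is strictly shorter. For elements with |\<alpha>| = |\<beta>| this turns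
  a nonzero product of idempotents into an equality of paths.\<close>

lemma path_prefix_same_length:
  assumes "path_prefix \<mu> \<nu> \<or> path_prefix \<nu> \<mu>" "path_length \<mu> = path_length \<nu>"
  shows "\<mu> = \<nu>"
  using assms by (auto simp: path_prefix_def path_length_def prefix_def prod_eq_iff)

lemma path_append_eq_same_length:
  assumes "path_append \<alpha> \<mu> = path_append \<beta> \<nu>" "path_length \<alpha> = path_length \<beta>"
  shows "\<alpha> = \<beta>"
  using assms by (auto simp: path_append_def path_length_def prod_eq_iff)

lemma path_rest_append [simp]:
  "path_rng \<nu> = path_src E \<mu> \<Longrightarrow> path_rest E \<mu> (path_append \<mu> \<nu>) = \<nu>"
  by (auto simp: path_append_def path_rest_def path_rng_def prod_eq_iff)

lemma (in wf_digraph) path_src_in_verts: "\<mu> \<in> paths G \<Longrightarrow> path_src G \<mu> \<in> verts G"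
  by (auto simp: paths_def path_src_def intro!: tail_in_verts intro: subsetD[OF _ last_in_set])

lemma (in wf_digraph) paths_append:
  assumes "path_rng \<nu> = path_src G \<mu>"
  shows "path_append \<mu> \<nu> \<in> paths G \<longleftrightarrow> \<mu> \<in> paths G \<and> \<nu> \<in> paths G"
proof -
  have *: "(v, xs @ ys) \<in> paths G \<longleftrightarrow> (v, xs) \<in> paths G \<and> (path_src G (v, xs), ys) \<in> paths G" for v xs ys
  proof (induction xs arbitrary: v)
    case Nil
    then show ?case by (auto simp: paths_def)
  qed auto
  show ?thesis
    using *[of "fst \<mu>" "snd \<mu>" "snd \<nu>"] assms by (cases \<nu>) (auto simp: path_append_def path_rng_def)
qed

text \<open>The remainder is given the range vertex \<open>path_src G \<mu>\<close>, the same choice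
  as in \<open>path_rest\<close>; this also covers an empty remainder.\<close>

lemma (in wf_digraph) path_prefixE:
  assumes "path_prefix \<mu> \<kappa>" "\<kappa> \<in> paths G"
  obtains \<nu> where "\<kappa> = path_append \<mu> \<nu>" "\<nu> \<in> paths G" "path_rng \<nu> = path_src G \<mu>" "\<mu> \<in> paths G"
proof -
  obtain zs where zs: "fst \<mu> = fst \<kappa>" "snd \<kappa> = snd \<mu> @ zs"
    using assms(1) by (auto simp: path_prefix_def prefix_def)
  let ?\<nu> = "(path_src G \<mu>, zs)"
  have "\<kappa> = path_append \<mu> ?\<nu>" "path_rng ?\<nu> = path_src G \<mu>"
    using zs by (auto simp: path_append_def path_rng_def prod_eq_iff)
  then show ?thesis
    using that[of ?\<nu>] paths_append[of ?\<nu> \<mu>] assms(2) by simp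
qed

section \<open>Action and restriction along paths\<close>

context self_similar_action
begin

text \<open>Quantified paths are kept as single variables, and \<open>x \<noteq> None\<close> is
  kept as a statement of nonvanishing.\<close>

declare split_paired_Ex [simp del] split_paired_All [simp del] not_None_eq [iff del]

text \<open>Induction on the edges, passing from \<open>g\<close> to \<open>res g e\<close>. By
  \<open>src_res\<close> and \<open>rng_res\<close> this arrow goes from the tail of
  \<open>e\<close> to the tail of \<open>act g e\<close>, which is what composability with the
  remaining edges requires on both sides.\<close>

lemma act_res_edges:
  assumes "(src \<Gamma> g, es) \<in> paths E" "g \<in> arrows \<Gamma>"
  shows "(rng \<Gamma> g, act_edges g es) \<in> paths E \<and> res_edges g es \<in> arrows \<Gamma> \<and>
    src \<Gamma> (res_edges g es) = path_src E (src \<Gamma> g, es) \<and>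
    rng \<Gamma> (res_edges g es) = path_src E (rng \<Gamma> g, act_edges g es)"
  using assms
proof (induction es arbitrary: g)
  case Nil
  then show ?case using units_eq_verts rng_in_units by auto
next
  case (Cons e es)
  then show ?case
    using Cons.IH[of "res g e"] by (simp add: act_closed head_act res_closed src_res rng_res)
qed

text \<open>The inductive step replaces \<open>g\<close> by \<open>res g e\<close> and
  \<open>h\<close> by \<open>res h (act g e)\<close>; these are composable because both meet at the
  tail of \<open>act g e\<close>.\<close>

lemma act_res_edges_comp:
  assumes "(src \<Gamma> g, es) \<in> paths E" "g \<in> arrows \<Gamma>" "h \<in> arrows \<Gamma>" "src \<Gamma> h = rng \<Gamma> g"
  shows "act_edges (h \<bullet> g) es = act_edges h (act_edges g es) \<and>
    res_edges (h \<bullet> g) es = res_edges h (act_edges g es) \<bullet> res_edges g es"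
  using assms
proof (induction es arbitrary: g h)
  case (Cons e es)
  then show ?case
    using Cons.IH[of "res g e" "res h (act g e)"]
    by (simp add: act_comp res_comp act_closed head_act res_closed src_res rng_res)
qed simp

text \<open>For the unit v = vv acting trivially on \<open>e\<close>, the rule for restricting a
  product makes \<open>res v e\<close> idempotent, hence a unit, and its source is the tail of
  \<open>e\<close>.\<close>

lemma res_unit:
  assumes "e \<in> arcs E" shows "res (head E e) e = tail E e"
proof -
  let ?v = "head E e"
  have v: "?v \<in> units \<Gamma>" using assms units_eq_verts by auto
  have "res (?v \<bullet> ?v) e = res ?v (act ?v e) \<bullet> res ?v e"
    using assms mem_units[OF v] by (intro res_comp) auto
  then have "res ?v e \<bullet> res ?v e = res ?v e"
    using assms mem_units[OF v] rng_left_unit[of ?v] by (simp add: act_unit)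
  then show ?thesis
    using idempotent_arrow[of "res ?v e"] assms mem_units[OF v]
    by (simp add: res_closed src_res rng_res act_unit)
qed

lemma act_res_edges_unit:
  "(v, es) \<in> paths E \<Longrightarrow> act_edges v es = es \<and> res_edges v es = path_src E (v, es)"
  by (induction es arbitrary: v) (auto simp: act_unit res_unit)

lemma act_res_edges_append:
  "act_edges g (xs @ ys) = act_edges g xs @ act_edges (res_edges g xs) ys \<and>
   res_edges g (xs @ ys) = res_edges (res_edges g xs) ys"
  by (induction xs arbitrary: g) auto

lemma mem_paths_with_range: "\<mu> \<in> paths_with_range v \<longleftrightarrow> \<mu> \<in> paths E \<and> path_rng \<mu> = v"
  by (simp add: paths_with_range_def)

lemma path_act_res:
  assumes "g \<in> arrows \<Gamma>" "\<mu> \<in> paths E" "path_rng \<mu> = src \<Gamma> g"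
  shows "path_act g \<mu> \<in> paths E" "path_rng (path_act g \<mu>) = rng \<Gamma> g"
    "path_res g \<mu> \<in> arrows \<Gamma>" "src \<Gamma> (path_res g \<mu>) = path_src E \<mu>"
    "rng \<Gamma> (path_res g \<mu>) = path_src E (path_act g \<mu>)"
  using act_res_edges[of g "snd \<mu>"] assms
  by (cases \<mu>; auto simp: path_act_def path_res_def path_rng_def)+

lemma path_length_act [simp]: "path_length (path_act g \<mu>) = path_length \<mu>"
proof -
  have "length (act_edges g es) = length es" for es
    by (induction es arbitrary: g) auto
  then show ?thesis by (simp add: path_length_def path_act_def)
qed

lemma path_act_res_comp:
  assumes "g \<in> arrows \<Gamma>" "h \<in> arrows \<Gamma>" "src \<Gamma> h = rng \<Gamma> g" "\<mu> \<in> paths E" "path_rng \<mu> = src \<Gamma> g"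
  shows "path_act (h \<bullet> g) \<mu> = path_act h (path_act g \<mu>)"
    "path_res (h \<bullet> g) \<mu> = path_res h (path_act g \<mu>) \<bullet> path_res g \<mu>"
  using act_res_edges_comp[of g "snd \<mu>" h] assms
  by (cases \<mu>; auto simp: path_act_def path_res_def path_rng_def rng_comp)+

lemma path_act_res_unit:
  assumes "\<mu> \<in> paths E" "path_rng \<mu> = v"
  shows "path_act v \<mu> = \<mu>" "path_res v \<mu> = path_src E \<mu>"
proof -
  have "v \<in> units \<Gamma>"
    using assms units_eq_verts by (auto simp: paths_def path_rng_def)
  then show "path_act v \<mu> = \<mu>" "path_res v \<mu> = path_src E \<mu>"
    using act_res_edges_unit[of v "snd \<mu>"] assms mem_units(2)[of v]
    by (cases \<mu>; auto simp: path_act_def path_res_def path_rng_def)+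
qed

lemma path_act_res_append:
  "path_act g (path_append \<mu> \<nu>) = path_append (path_act g \<mu>) (path_act (path_res g \<mu>) \<nu>)"
  "path_res g (path_append \<mu> \<nu>) = path_res (path_res g \<mu>) \<nu>"
  by (simp_all add: path_act_def path_res_def path_append_def act_res_edges_append)

lemma path_act_Nil [simp]: "path_act g (v, []) = (rng \<Gamma> g, [])"
  by (simp add: path_act_def)

lemma path_res_Nil [simp]: "path_res g (v, []) = g"
  by (simp add: path_res_def)

text \<open>Both claims come from applying the product rules to
  \<open>ginv \<Gamma> g \<bullet> g = src \<Gamma> g\<close>, a unit; the second then uses
  uniqueness of left inverses.\<close>

lemma path_act_ginv:
  assumes "g \<in> arrows \<Gamma>" "\<mu> \<in> paths E" "path_rng \<mu> = src \<Gamma> g"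
  shows "path_act (ginv \<Gamma> g) (path_act g \<mu>) = \<mu>"
    "path_res (ginv \<Gamma> g) (path_act g \<mu>) = ginv \<Gamma> (path_res g \<mu>)"
proof -
  have i: "ginv \<Gamma> g \<in> arrows \<Gamma>" "src \<Gamma> (ginv \<Gamma> g) = rng \<Gamma> g" "ginv \<Gamma> g \<bullet> g = src \<Gamma> g"
    using assms by (auto simp: inv_closed src_inv left_inv)
  note c = path_act_res_comp[OF assms(1) i(1,2) assms(2,3), unfolded i(3)]
  note u = path_act_res_unit[OF assms(2,3)]
  note r = path_act_res[OF assms]
  show "path_act (ginv \<Gamma> g) (path_act g \<mu>) = \<mu>" using c u by simp
  show "path_res (ginv \<Gamma> g) (path_act g \<mu>) = ginv \<Gamma> (path_res g \<mu>)"
    using c u r i path_act_res[of "ginv \<Gamma> g" "path_act g \<mu>"] by (intro ginv_unique) auto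
qed

section \<open>Products and idempotents of the semigroup of triples\<close>

lemma carrier_S_GE:
  "Some (\<alpha>, g, \<beta>) \<in> carrier S_GE \<longleftrightarrow> \<alpha> \<in> paths E \<and> \<beta> \<in> paths E \<and> g \<in> arrows \<Gamma> \<and>
     rng \<Gamma> g = path_src E \<alpha> \<and> src \<Gamma> g = path_src E \<beta>"
  by (simp add: S_GE_def)

lemma S_GE_sel [simp]: "mult S_GE = ss_mult" "star S_GE = ss_star" "zero S_GE = None"
  by (simp_all add: S_GE_def)

text \<open>Writing the longer path as a concatenation removes the prefix test and the remainder
  from the product.\<close>

lemma ss_mult_append_right:
  assumes "path_rng \<mu> = path_src E \<beta>"
  shows "ss_mult (Some (\<alpha>, g, \<beta>)) (Some (path_append \<beta> \<mu>, h, \<delta>)) =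
    Some (path_append \<alpha> (path_act g \<mu>), path_res g \<mu> \<bullet> h, \<delta>)"
  using assms by (simp add: Let_def)

text \<open>For \<open>\<mu>\<close> of length \<open>0\<close> the first branch of the multiplication applies; there the two
  formulas agree.\<close>

lemma ss_mult_append_left:
  assumes "path_rng \<mu> = path_src E \<gamma>" "h \<in> arrows \<Gamma>"
  shows "ss_mult (Some (\<alpha>, g, path_append \<gamma> \<mu>)) (Some (\<gamma>, h, \<delta>)) =
    Some (\<alpha>, g \<bullet> ginv \<Gamma> (path_res (ginv \<Gamma> h) \<mu>), path_append \<delta> (path_act (ginv \<Gamma> h) \<mu>))"
proof (cases "path_prefix (path_append \<gamma> \<mu>) \<gamma>")
  case True
  then have "snd \<mu> = []" by (auto simp: path_prefix_def path_append_def prefix_def)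
  then have \<mu>: "\<mu> = (path_src E \<gamma>, [])" using assms(1) by (auto simp: path_rng_def prod_eq_iff)
  show ?thesis
    using assms(2) unfolding \<mu> by (simp add: path_rest_def Let_def ginv_ginv)
next
  case False
  then show ?thesis using assms by (simp add: Let_def)
qed

text \<open>This is \<open>e\<^sub>\<mu>\<close>; that zero and these elements are all the
  idempotents is shown in \<open>idempotents_S_GE\<close>.\<close>

definition path_idem :: "('g, 'e) gpath \<Rightarrow> (('g, 'e) gpath \<times> 'g \<times> ('g, 'e) gpath) option" where
  "path_idem \<mu> = Some (\<mu>, path_src E \<mu>, \<mu>)"

lemma path_idem_ne [simp]: "path_idem \<mu> \<noteq> None" "None \<noteq> path_idem \<mu>"
  by (simp_all add: path_idem_def)

lemma path_idem_inj [simp]: "path_idem \<mu> = path_idem \<nu> \<longleftrightarrow> \<mu> = \<nu>"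
  by (auto simp: path_idem_def)

lemma path_src_unit:
  assumes "\<mu> \<in> paths E"
  shows "path_src E \<mu> \<in> units \<Gamma>" "path_src E \<mu> \<in> arrows \<Gamma>" "rng \<Gamma> (path_src E \<mu>) = path_src E \<mu>"
    "src \<Gamma> (path_src E \<mu>) = path_src E \<mu>" "ginv \<Gamma> (path_src E \<mu>) = path_src E \<mu>"
proof -
  show u: "path_src E \<mu> \<in> units \<Gamma>"
    using assms by (simp add: units_eq_verts path_src_in_verts)
  show "path_src E \<mu> \<in> arrows \<Gamma>" "rng \<Gamma> (path_src E \<mu>) = path_src E \<mu>"
    "src \<Gamma> (path_src E \<mu>) = path_src E \<mu>" "ginv \<Gamma> (path_src E \<mu>) = path_src E \<mu>"
    using mem_units[OF u] ginv_unit[OF u] by auto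
qed

lemma ss_star_path_idem [simp]: "\<mu> \<in> paths E \<Longrightarrow> ss_star (path_idem \<mu>) = path_idem \<mu>"
  by (simp add: path_idem_def path_src_unit)

lemma path_idem_in_carrier: "\<mu> \<in> paths E \<Longrightarrow> path_idem \<mu> \<in> carrier S_GE"
  by (simp add: path_idem_def carrier_S_GE path_src_unit)

lemma path_idem_mult_append:
  assumes "\<mu> \<in> paths E" "path_append \<mu> \<nu> \<in> paths E" "path_rng \<nu> = path_src E \<mu>"
  shows "ss_mult (path_idem \<mu>) (path_idem (path_append \<mu> \<nu>)) = path_idem (path_append \<mu> \<nu>)"
    "ss_mult (path_idem (path_append \<mu> \<nu>)) (path_idem \<mu>) = path_idem (path_append \<mu> \<nu>)"
proof -
  have \<nu>: "\<nu> \<in> paths E" using assms paths_append[of \<nu> \<mu>] by simp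
  note u = path_act_res_unit[OF \<nu> assms(3)] and s = path_src_unit[OF \<nu>] and m = path_src_unit[OF assms(1)]
  have uu: "path_src E \<nu> \<bullet> path_src E \<nu> = path_src E \<nu>"
    using rng_left_unit[of "path_src E \<nu>"] s by simp
  show "ss_mult (path_idem \<mu>) (path_idem (path_append \<mu> \<nu>)) = path_idem (path_append \<mu> \<nu>)"
    using assms u uu unfolding path_idem_def by (subst ss_mult_append_right) auto
  show "ss_mult (path_idem (path_append \<mu> \<nu>)) (path_idem \<mu>) = path_idem (path_append \<mu> \<nu>)"
    using assms u uu s m unfolding path_idem_def by (subst ss_mult_append_left) auto
qed

lemma path_idem_mult_ne_iff:
  "ss_mult (path_idem \<mu>) (path_idem \<nu>) \<noteq> None \<longleftrightarrow> path_prefix \<mu> \<nu> \<or> path_prefix \<nu> \<mu>"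
  by (simp add: path_idem_def Let_def)

text \<open>A nonzero square makes \<alpha> and \<beta> comparable. As the action preserves length,
  comparing lengths in the square shows that the remainder is empty, so \<alpha> = \<beta>; then
  \<open>g\<close> is an idempotent arrow and hence a unit.\<close>

lemma idempotents_S_GE: "idempotents S_GE = insert None (path_idem ` paths E)"
proof (intro equalityI subsetI)
  fix x assume x: "x \<in> idempotents S_GE"
  show "x \<in> insert None (path_idem ` paths E)"
  proof (cases x)
    case (Some y)
    obtain \<alpha> g \<beta> where y: "y = (\<alpha>, g, \<beta>)" by (cases y)
    have c: "\<alpha> \<in> paths E" "\<beta> \<in> paths E" "g \<in> arrows \<Gamma>" "rng \<Gamma> g = path_src E \<alpha>" "src \<Gamma> g = path_src E \<beta>"
      and sq: "ss_mult (Some (\<alpha>, g, \<beta>)) (Some (\<alpha>, g, \<beta>)) = Some (\<alpha>, g, \<beta>)"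
      using x by (auto simp: idempotents_def Some y carrier_S_GE)
    have "path_prefix \<beta> \<alpha> \<or> path_prefix \<alpha> \<beta>"
      using sq by (auto split: if_splits)
    then have eq: "\<alpha> = \<beta>"
    proof
      assume "path_prefix \<beta> \<alpha>"
      then obtain \<mu> where \<mu>: "\<alpha> = path_append \<beta> \<mu>" "path_rng \<mu> = path_src E \<beta>"
        using c path_prefixE by metis
      then have "path_append \<alpha> (path_act g \<mu>) = \<alpha>"
        using sq ss_mult_append_right[OF \<mu>(2), of \<alpha> g g \<beta>] by simp
      then have "path_length \<mu> = 0"
        by (metis add_cancel_right_right path_length_act path_length_append)
      with \<mu> show ?thesis by (simp add: path_length_def path_append_def)
    next
      assume "path_prefix \<alpha> \<beta>"
      then obtain \<mu> where \<mu>: "\<beta> = path_append \<alpha> \<mu>" "path_rng \<mu> = path_src E \<alpha>"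
        using c path_prefixE by metis
      then have "path_append \<beta> (path_act (ginv \<Gamma> g) \<mu>) = \<beta>"
        using sq ss_mult_append_left[OF \<mu>(2) c(3), of \<alpha> g \<beta>] by simp
      then have "path_length \<mu> = 0"
        by (metis add_cancel_right_right path_length_act path_length_append)
      with \<mu> show ?thesis by (simp add: path_length_def path_append_def)
    qed
    have "g \<bullet> g = g"
      using sq eq by (simp add: path_rest_def Let_def)
    then have "g = path_src E \<alpha>"
      using idempotent_arrow[of g] c eq by simp
    then show ?thesis using Some y eq c by (auto simp: path_idem_def)
  qed simp
next
  fix x assume "x \<in> insert None (path_idem ` paths E)"
  moreover have "ss_mult (path_idem \<mu>) (path_idem \<mu>) = path_idem \<mu>" if "\<mu> \<in> paths E" for \<mu>
    using path_idem_mult_append(1)[of \<mu> "(path_src E \<mu>, [])"] that by (simp add: path_rng_def)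
  moreover have "None \<in> carrier S_GE" by (simp add: S_GE_def)
  ultimately show "x \<in> idempotents S_GE"
    by (auto simp: idempotents_def path_idem_in_carrier)
qed

section \<open>Conjugation of idempotents and the natural order\<close>

lemma restrict_mult_right:
  assumes "Some (\<alpha>, g, \<beta>) \<in> carrier S_GE" "\<mu> \<in> paths E" "path_rng \<mu> = path_src E \<beta>"
  shows "ss_mult (Some (\<alpha>, g, \<beta>)) (path_idem (path_append \<beta> \<mu>)) =
    Some (path_append \<alpha> (path_act g \<mu>), path_res g \<mu>, path_append \<beta> \<mu>)"
proof -
  note c = assms(1)[unfolded carrier_S_GE]
  have "path_rng \<mu> = src \<Gamma> g" using c assms by simp
  then have "path_res g \<mu> \<bullet> path_src E \<mu> = path_res g \<mu>"
    using path_act_res[of g \<mu>] src_right_unit[of "path_res g \<mu>"] c assms by simp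
  then show ?thesis
    unfolding path_idem_def using assms by (subst ss_mult_append_right) auto
qed

text \<open>Restricting to \<beta>\<mu> and multiplying by the star leaves
  \<open>path_res g \<mu>\<close> times its inverse in the middle, which is the source of
  \<open>path_act g \<mu>\<close>.\<close>

lemma conj_append:
  assumes "Some (\<alpha>, g, \<beta>) \<in> carrier S_GE" "\<mu> \<in> paths E" "path_rng \<mu> = path_src E \<beta>"
  shows "ss_mult (ss_mult (Some (\<alpha>, g, \<beta>)) (path_idem (path_append \<beta> \<mu>))) (ss_star (Some (\<alpha>, g, \<beta>))) =
    path_idem (path_append \<alpha> (path_act g \<mu>))"
proof -
  note c = assms(1)[unfolded carrier_S_GE]
  have "path_rng \<mu> = src \<Gamma> g" using c assms by simp
  then have r: "path_res g \<mu> \<in> arrows \<Gamma>" "rng \<Gamma> (path_res g \<mu>) = path_src E (path_act g \<mu>)"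
    "path_rng (path_act g \<mu>) = path_src E \<alpha>"
    using path_act_res[of g \<mu>] c assms by auto
  show ?thesis
    unfolding restrict_mult_right[OF assms] ss_star.simps
    using assms c r by (subst ss_mult_append_left) (auto simp: inv_closed ginv_ginv path_idem_def right_inv)
qed

text \<open>Here \<open>e\<^sub>\<gamma>\<close> is a right identity for t = (\<alpha>, g, \<beta>),
  so the conjugate is t times its star.\<close>

lemma conj_prefix:
  assumes "Some (\<alpha>, g, \<beta>) \<in> carrier S_GE" "path_prefix \<gamma> \<beta>"
  shows "ss_mult (ss_mult (Some (\<alpha>, g, \<beta>)) (path_idem \<gamma>)) (ss_star (Some (\<alpha>, g, \<beta>))) = path_idem \<alpha>"
proof -
  note c = assms(1)[unfolded carrier_S_GE]
  obtain \<mu> where \<mu>: "\<beta> = path_append \<gamma> \<mu>" "\<mu> \<in> paths E" "path_rng \<mu> = path_src E \<gamma>" "\<gamma> \<in> paths E"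
    using path_prefixE[OF assms(2)] c by metis
  have "g \<bullet> path_src E \<mu> = g" using c \<mu> src_right_unit[of g] by simp
  then have "ss_mult (Some (\<alpha>, g, \<beta>)) (path_idem \<gamma>) = Some (\<alpha>, g, \<beta>)"
    unfolding path_idem_def \<mu>(1) using \<mu> path_act_res_unit[OF \<mu>(2,3)] path_src_unit[OF \<mu>(4)] path_src_unit[OF \<mu>(2)]
    by (subst ss_mult_append_left) auto
  then show ?thesis
    using c by (simp add: path_rest_def Let_def path_idem_def right_inv)
qed

lemma conj_incomparable:
  assumes "\<not> path_prefix \<beta> \<gamma>" "\<not> path_prefix \<gamma> \<beta>"
  shows "ss_mult (ss_mult (Some (\<alpha>, g, \<beta>)) (path_idem \<gamma>)) (ss_star (Some (\<alpha>, g, \<beta>))) = None"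
  using assms by (simp add: path_idem_def)

text \<open>In the product defining the order, \<gamma> and \<open>k\<close> cancel: only the third
  entry \<beta>\<mu> survives. So an element below (\<alpha>, g, \<beta>) is determined by its third
  entry, as the restriction to it.\<close>

lemma below_append_iff:
  assumes "Some (\<alpha>, g, \<beta>) \<in> carrier S_GE" "Some (\<gamma>, k, path_append \<beta> \<mu>) \<in> carrier S_GE"
    "path_rng \<mu> = path_src E \<beta>"
  shows "below S_GE (Some (\<gamma>, k, path_append \<beta> \<mu>)) (Some (\<alpha>, g, \<beta>)) \<longleftrightarrow>
    \<gamma> = path_append \<alpha> (path_act g \<mu>) \<and> k = path_res g \<mu>"
proof -
  note c = assms(1)[unfolded carrier_S_GE]
  note d = assms(2)[unfolded carrier_S_GE]
  have \<mu>: "\<mu> \<in> paths E" using d assms(3) paths_append by blast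
  have rm: "path_rng \<mu> = src \<Gamma> g" using c assms by simp
  have k: "src \<Gamma> (path_res g \<mu>) = src \<Gamma> k" "path_res g \<mu> \<in> arrows \<Gamma>" "k \<in> arrows \<Gamma>" "rng \<Gamma> k = path_src E \<gamma>"
    using d assms(3) path_act_res[OF _ \<mu> rm] c by auto
  have "(path_res g \<mu> \<bullet> ginv \<Gamma> k) \<bullet> k = path_res g \<mu> \<bullet> (ginv \<Gamma> k \<bullet> k)"
    using k by (intro comp_assoc) (auto simp: inv_closed rng_inv src_inv)
  also have "\<dots> = path_res g \<mu>"
    using k src_right_unit[of "path_res g \<mu>"] by (simp add: left_inv)
  finally have "path_res g \<mu> \<bullet> ginv \<Gamma> k \<bullet> k = path_res g \<mu>" .
  then have "ss_mult (ss_mult (Some (\<alpha>, g, \<beta>)) (ss_star (Some (\<gamma>, k, path_append \<beta> \<mu>))))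
      (Some (\<gamma>, k, path_append \<beta> \<mu>)) =
    Some (path_append \<alpha> (path_act g \<mu>), path_res g \<mu>, path_append \<beta> \<mu>)"
    unfolding ss_star.simps ss_mult_append_right[OF assms(3)]
    by (simp add: path_rest_def Let_def)
  then show ?thesis by (auto simp: below_def)
qed

lemma below_path_idem_append:
  assumes "\<mu> \<in> paths E" "path_append \<mu> \<nu> \<in> paths E" "path_rng \<nu> = path_src E \<mu>"
  shows "below S_GE (path_idem (path_append \<mu> \<nu>)) (path_idem \<mu>)"
  using path_idem_mult_append[OF assms] path_idem_mult_append(1)[of "path_append \<mu> \<nu>" "(path_src E \<nu>, [])"] assms
  by (simp add: below_def path_rng_def)

lemma below_path_idem_range:
  assumes "\<mu> \<in> paths E" "below S_GE (path_idem \<mu>) (path_idem (v, []))"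
  shows "path_rng \<mu> = v"
proof -
  have "ss_mult (path_idem (v, [])) (path_idem \<mu>) \<noteq> None"
    using assms by (auto simp: below_def)
  then show ?thesis
    unfolding path_idem_mult_ne_iff path_prefix_Nil path_prefix_into_Nil
    by (auto simp: path_rng_def)
qed

section \<open>Arrows fixing all paths, the common premise of \<open>Evr\<close> and
  \<open>faithful\<close>\<close>

definition fixes_all :: "'g \<Rightarrow> bool" where
  "fixes_all g \<longleftrightarrow> (\<forall>\<mu> \<in> paths_with_range (src \<Gamma> g). path_act g \<mu> = \<mu>)"

text \<open>With vertices as outer paths, conjugation by this element is the bare action of
  \<open>g\<close>.\<close>

definition vertex_path_elem :: "'g \<Rightarrow> (('g, 'e) gpath \<times> 'g \<times> ('g, 'e) gpath) option" where
  "vertex_path_elem g = Some ((rng \<Gamma> g, []), g, (src \<Gamma> g, []))"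

lemma vertex_path_elem_in_carrier: "g \<in> arrows \<Gamma> \<Longrightarrow> vertex_path_elem g \<in> carrier S_GE"
  by (simp add: vertex_path_elem_def carrier_S_GE rng_in_units src_in_units units_eq_verts[symmetric])

text \<open>Apply the assumption to the path of length 0 at s(g), which \<open>g\<close> sends to
  r(g).\<close>

lemma fixes_all_rng: "g \<in> arrows \<Gamma> \<Longrightarrow> fixes_all g \<Longrightarrow> rng \<Gamma> g = src \<Gamma> g"
  unfolding fixes_all_def
  by (drule bspec[of _ _ "(src \<Gamma> g, [])"])
     (auto simp: mem_paths_with_range path_rng_def src_in_units units_eq_verts[symmetric])

text \<open>The value depends on \<open>g\<close> only through its source, so \<open>g\<close>
  cannot be told apart from the unit s(g) by conjugation; see
  \<open>same_conjugation_vertex_path_elem\<close>.\<close>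

lemma vertex_path_elem_conj:
  assumes "g \<in> arrows \<Gamma>" "fixes_all g" "\<mu> \<in> paths E"
  shows "ss_mult (ss_mult (vertex_path_elem g) (path_idem \<mu>)) (ss_star (vertex_path_elem g)) =
    (if path_rng \<mu> = src \<Gamma> g then path_idem \<mu> else None)"
proof (cases "path_rng \<mu> = src \<Gamma> g")
  case True
  have "path_act g \<mu> = \<mu>" using assms True by (simp add: fixes_all_def mem_paths_with_range)
  then show ?thesis
    using conj_append[of "(rng \<Gamma> g, [])" g "(src \<Gamma> g, [])" \<mu>] vertex_path_elem_in_carrier[OF assms(1)] assms True
    by (simp add: vertex_path_elem_def path_Nil_append fixes_all_rng)
next
  case False
  then have "\<not> path_prefix (src \<Gamma> g, []) \<mu>" "\<not> path_prefix \<mu> (src \<Gamma> g, [])"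
    by (auto simp: path_prefix_Nil path_prefix_into_Nil path_rng_def)
  then show ?thesis
    using False conj_incomparable unfolding vertex_path_elem_def by simp
qed

lemma below_vertex_path_elem:
  assumes "g \<in> arrows \<Gamma>" "Some (\<gamma>, k, \<mu>) \<in> carrier S_GE" "path_rng \<mu> = src \<Gamma> g"
    "below S_GE (Some (\<gamma>, k, \<mu>)) (vertex_path_elem g)"
  shows "\<gamma> = path_act g \<mu>" "k = path_res g \<mu>"
proof -
  have e: "path_append (src \<Gamma> g, []) \<mu> = \<mu>" using assms by (simp add: path_Nil_append)
  have "path_rng (path_act g \<mu>) = rng \<Gamma> g" by (simp add: path_act_def path_rng_def)
  then have e': "path_append (rng \<Gamma> g, []) (path_act g \<mu>) = path_act g \<mu>" by (simp add: path_Nil_append)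
  show "\<gamma> = path_act g \<mu>" "k = path_res g \<mu>"
    using below_append_iff[of "(rng \<Gamma> g, [])" g "(src \<Gamma> g, [])" \<gamma> k \<mu>] assms e e'
      vertex_path_elem_in_carrier[OF assms(1)]
    by (auto simp: vertex_path_elem_def)
qed

section \<open>Elements with the same conjugation\<close>

lemma same_conjugation_iff:
  "same_conjugation S_GE s t \<longleftrightarrow> (\<forall>\<mu> \<in> paths E.
     ss_mult (ss_mult s (path_idem \<mu>)) (ss_star s) = ss_mult (ss_mult t (path_idem \<mu>)) (ss_star t))"
proof -
  have "ss_mult x None = None" for x by (cases x) auto
  then show ?thesis by (simp add: same_conjugation_def idempotents_S_GE)
qed

lemma same_conjugation_vertex_path_elem:
  assumes "g \<in> arrows \<Gamma>" "fixes_all g"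
  shows "same_conjugation S_GE (vertex_path_elem g) (vertex_path_elem (src \<Gamma> g))"
proof -
  have "fixes_all (src \<Gamma> g)"
    using assms by (auto simp: fixes_all_def mem_paths_with_range src_src path_act_res_unit)
  then show ?thesis
    using assms by (simp add: same_conjugation_iff vertex_path_elem_conj src_closed src_src)
qed

text \<open>Let \<beta> = \<delta>\<mu>. The first element sends both \<open>e\<^sub>\<beta>\<close>
  and \<open>e\<^sub>\<delta>\<close> to \<open>e\<^sub>\<alpha>\<close>, while the second sends
  them to the idempotents of \<gamma>(h\<mu>) and \<gamma>. Hence \<gamma>(h\<mu>) = \<gamma>, and
  \<mu> has length 0.\<close>

lemma same_conjugation_endpoints:
  assumes s: "Some (\<alpha>, g, \<beta>) \<in> carrier S_GE" and t: "Some (\<gamma>, h, \<delta>) \<in> carrier S_GE"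
    and same: "same_conjugation S_GE (Some (\<alpha>, g, \<beta>)) (Some (\<gamma>, h, \<delta>))"
    and pre: "path_prefix \<delta> \<beta>"
  shows "\<alpha> = \<gamma> \<and> \<beta> = \<delta>"
proof -
  note c = s[unfolded carrier_S_GE] and d = t[unfolded carrier_S_GE]
  note eq = same[unfolded same_conjugation_iff, rule_format]
  obtain \<mu> where \<mu>: "\<beta> = path_append \<delta> \<mu>" "\<mu> \<in> paths E" "path_rng \<mu> = path_src E \<delta>"
    using path_prefixE[OF pre] c by metis
  have "path_idem \<alpha> = path_idem (path_append \<gamma> (path_act h \<mu>))"
    using eq[of \<beta>] conj_prefix[OF s, of \<beta>] conj_append[OF t \<mu>(2,3)] c \<mu>(1) by simp
  moreover have "path_idem \<alpha> = path_idem \<gamma>"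
    using eq[of \<delta>] conj_prefix[OF s pre] conj_prefix[OF t, of \<delta>] d by simp
  ultimately have "\<alpha> = \<gamma>" "path_append \<gamma> (path_act h \<mu>) = \<gamma>" by simp_all
  then have "path_length \<mu> = 0"
    by (metis add_cancel_right_right path_length_act path_length_append)
  with \<mu> \<open>\<alpha> = \<gamma>\<close> show ?thesis by (simp add: path_length_def path_append_def)
qed

lemma same_conjugationE:
  assumes s: "Some (\<alpha>, g, \<beta>) \<in> carrier S_GE" and t: "Some (\<gamma>, h, \<delta>) \<in> carrier S_GE"
    and same: "same_conjugation S_GE (Some (\<alpha>, g, \<beta>)) (Some (\<gamma>, h, \<delta>))"
  shows "\<alpha> = \<gamma>" "\<beta> = \<delta>"
    "\<And>\<mu>. \<lbrakk>\<mu> \<in> paths E; path_rng \<mu> = src \<Gamma> g\<rbrakk> \<Longrightarrow> path_act g \<mu> = path_act h \<mu>"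
proof -
  note c = s[unfolded carrier_S_GE] and d = t[unfolded carrier_S_GE]
  note eq = same[unfolded same_conjugation_iff, rule_format]
  \<comment> \<open>Otherwise the second element conjugates \<open>e\<^sub>\<beta>\<close> to zero,
    while the first conjugates it to \<open>e\<^sub>\<alpha>\<close>.\<close>
  have "path_prefix \<delta> \<beta> \<or> path_prefix \<beta> \<delta>"
  proof (rule ccontr)
    assume "\<not> ?thesis"
    then show False using eq[of \<beta>] conj_prefix[OF s, of \<beta>] conj_incomparable[of \<delta> \<beta> \<gamma> h] c by auto
  qed
  moreover have "same_conjugation S_GE (Some (\<gamma>, h, \<delta>)) (Some (\<alpha>, g, \<beta>))"
    using same by (simp add: same_conjugation_def)
  ultimately show e: "\<alpha> = \<gamma>" "\<beta> = \<delta>"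
    using same_conjugation_endpoints[OF s t same] same_conjugation_endpoints[OF t s] by auto
  fix \<mu> assume \<mu>: "\<mu> \<in> paths E" "path_rng \<mu> = src \<Gamma> g"
  have "path_append \<beta> \<mu> \<in> paths E" using \<mu> c paths_append by simp
  then have "path_append \<alpha> (path_act g \<mu>) = path_append \<alpha> (path_act h \<mu>)"
    using eq[of "path_append \<beta> \<mu>"] conj_append[OF s \<mu>(1)] conj_append[OF t \<mu>(1)] \<mu> c e by simp
  moreover have "path_rng (path_act g \<mu>) = path_rng (path_act h \<mu>)"
    using c d e by (simp add: path_act_def path_rng_def)
  ultimately show "path_act g \<mu> = path_act h \<mu>"
    by (rule path_append_cancel)
qed

lemma fixes_all_quotient:
  assumes "g \<in> arrows \<Gamma>" "h \<in> arrows \<Gamma>" "rng \<Gamma> g = rng \<Gamma> h" "src \<Gamma> g = src \<Gamma> h"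
    and "\<And>\<mu>. \<lbrakk>\<mu> \<in> paths E; path_rng \<mu> = src \<Gamma> g\<rbrakk> \<Longrightarrow> path_act g \<mu> = path_act h \<mu>"
  shows "ginv \<Gamma> h \<bullet> g \<in> arrows \<Gamma>" "src \<Gamma> (ginv \<Gamma> h \<bullet> g) = src \<Gamma> g" "fixes_all (ginv \<Gamma> h \<bullet> g)"
proof -
  have *: "ginv \<Gamma> h \<in> arrows \<Gamma>" "src \<Gamma> (ginv \<Gamma> h) = rng \<Gamma> g"
    using assms by (auto simp: inv_closed src_inv)
  show a: "ginv \<Gamma> h \<bullet> g \<in> arrows \<Gamma>" "src \<Gamma> (ginv \<Gamma> h \<bullet> g) = src \<Gamma> g"
    using * assms by (auto simp: comp_closed src_comp)
  show "fixes_all (ginv \<Gamma> h \<bullet> g)"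
    unfolding fixes_all_def a mem_paths_with_range
  proof (intro ballI)
    fix \<mu> assume "\<mu> \<in> paths_with_range (src \<Gamma> g)"
    then have \<mu>: "\<mu> \<in> paths E" "path_rng \<mu> = src \<Gamma> g" by (simp_all add: mem_paths_with_range)
    show "path_act (ginv \<Gamma> h \<bullet> g) \<mu> = \<mu>"
      using path_act_res_comp(1)[OF assms(1) * \<mu>] path_act_ginv(1)[OF assms(2) \<mu>(1)] assms(4,5) \<mu> by simp
  qed
qed

lemma eq_if_ginv_comp_unit:
  assumes "g \<in> arrows \<Gamma>" "h \<in> arrows \<Gamma>" "rng \<Gamma> g = rng \<Gamma> h" "ginv \<Gamma> h \<bullet> g = src \<Gamma> g"
  shows "g = h"
proof -
  have "ginv \<Gamma> h = ginv \<Gamma> g"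
    using assms by (intro ginv_unique) (auto simp: inv_closed src_inv)
  then show ?thesis using assms ginv_ginv by metis
qed

section \<open>Quasi-fundamentality and fundamentality\<close>

lemma Evr_iff:
  "Evr \<longleftrightarrow> (\<forall>g \<in> arrows \<Gamma>. fixes_all g \<longrightarrow>
     (\<exists>\<mu> \<in> paths_with_range (src \<Gamma> g). path_act g \<mu> = \<mu> \<and> path_res g \<mu> = path_src E \<mu>))"
  by (simp add: Evr_def fixes_all_def fixes_path_def strongly_fixes_path_def)

lemma faithful_iff: "faithful \<longleftrightarrow> (\<forall>g \<in> arrows \<Gamma>. fixes_all g \<longrightarrow> g \<in> units \<Gamma>)"
  by (simp add: faithful_def fixes_all_def fixes_path_def)

text \<open>If \<open>h\<^sup>-\<^sup>1 g\<close> strongly fixes \<mu>, then \<open>g\<close> and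
  \<open>h\<close> have the same restriction along \<mu>, so both elements restrict to the same
  element on \<beta>\<mu>.\<close>

lemma Evr_imp_quasi_fundamental:
  assumes Evr shows "quasi_fundamental S_GE"
  unfolding quasi_fundamental_def
proof (intro ballI impI)
  fix s t assume st: "s \<in> carrier S_GE - {zero S_GE}" "t \<in> carrier S_GE - {zero S_GE}"
    and same: "same_conjugation S_GE s t"
  then obtain \<alpha> g \<beta> \<gamma> h \<delta> where s: "s = Some (\<alpha>, g, \<beta>)" and t: "t = Some (\<gamma>, h, \<delta>)"
    by (auto simp: not_None_eq)
  have sc: "Some (\<alpha>, g, \<beta>) \<in> carrier S_GE" and tc: "Some (\<gamma>, h, \<delta>) \<in> carrier S_GE"
    using st s t by auto
  note c = sc[unfolded carrier_S_GE] and d = tc[unfolded carrier_S_GE]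
  note e = same_conjugationE[OF sc tc same[unfolded s t]]
  have gh: "g \<in> arrows \<Gamma>" "h \<in> arrows \<Gamma>" "rng \<Gamma> g = rng \<Gamma> h" "src \<Gamma> g = src \<Gamma> h"
    using c d e(1,2) by auto
  note q = fixes_all_quotient[OF gh e(3)]
  then obtain \<mu> where \<mu>: "\<mu> \<in> paths E" "path_rng \<mu> = src \<Gamma> g"
    "path_res (ginv \<Gamma> h \<bullet> g) \<mu> = path_src E \<mu>"
    using assms Evr_iff mem_paths_with_range by metis
  note a = path_act_res[OF gh(1) \<mu>(1,2)] and b = path_act_res[OF gh(2) \<mu>(1) \<mu>(2)[unfolded gh(4)]]
  \<comment> \<open>Since g\<mu> = h\<mu>, the first factor is the inverse of
    \<open>path_res h \<mu>\<close>; strong fixing makes the product a unit, which forces the two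
    restrictions to agree.\<close>
  have "path_res (ginv \<Gamma> h \<bullet> g) \<mu> = path_res (ginv \<Gamma> h) (path_act h \<mu>) \<bullet> path_res g \<mu>"
    using gh \<mu> e(3)[OF \<mu>(1,2)] by (subst path_act_res_comp) (auto simp: inv_closed src_inv)
  then have "ginv \<Gamma> (path_res h \<mu>) \<bullet> path_res g \<mu> = src \<Gamma> (path_res g \<mu>)"
    using \<mu> gh a by (simp add: path_act_ginv)
  then have res: "path_res g \<mu> = path_res h \<mu>"
    by (rule eq_if_ginv_comp_unit[rotated 3]) (use a b e(3)[OF \<mu>(1,2)] in auto)
  let ?u = "Some (path_append \<alpha> (path_act g \<mu>), path_res g \<mu>, path_append \<beta> \<mu>)"
  have m: "path_rng \<mu> = path_src E \<beta>" using c \<mu> by simp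
  have u: "?u \<in> carrier S_GE"
    using a c \<mu> m paths_append by (auto simp: carrier_S_GE)
  show "\<exists>u \<in> carrier S_GE - {zero S_GE}. below S_GE u s \<and> below S_GE u t"
  proof (rule bexI[of _ ?u])
    show "below S_GE ?u s \<and> below S_GE ?u t"
      unfolding s t using below_append_iff[OF sc u m] below_append_iff[of \<gamma> h \<beta> _ _ \<mu>] u tc m e res \<mu> by simp
  qed (use u in simp)
qed

text \<open>A common lower bound of the elements for \<open>g\<close> and for the unit s(g) has
  third entry \<mu> and middle entry equal to both \<open>path_res g \<mu>\<close> and s(\<mu>), so
  \<mu> is strongly fixed.\<close>

lemma quasi_fundamental_imp_Evr:
  assumes "quasi_fundamental S_GE" shows Evr
  unfolding Evr_iff
proof (intro ballI impI)
  fix g assume g: "g \<in> arrows \<Gamma>" "fixes_all g"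
  have ne: "vertex_path_elem h \<noteq> None" for h by (simp add: vertex_path_elem_def)
  obtain u where u0: "u \<in> carrier S_GE" "u \<noteq> None" "below S_GE u (vertex_path_elem g)"
    "below S_GE u (vertex_path_elem (src \<Gamma> g))"
    using assms[unfolded quasi_fundamental_def, rule_format, OF _ _ same_conjugation_vertex_path_elem[OF g]]
      vertex_path_elem_in_carrier g src_closed ne by auto
  moreover obtain \<gamma> k \<mu> where "u = Some (\<gamma>, k, \<mu>)"
    using u0(2) by (metis not_None_eq prod_cases3)
  ultimately have u: "Some (\<gamma>, k, \<mu>) \<in> carrier S_GE"
    "below S_GE (Some (\<gamma>, k, \<mu>)) (vertex_path_elem g)"
    "below S_GE (Some (\<gamma>, k, \<mu>)) (vertex_path_elem (src \<Gamma> g))" by simp_all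
  \<comment> \<open>A vanishing product here would make \<open>u\<close> zero; its being nonzero
    forces \<mu> to have range s(g).\<close>
  have "ss_mult (vertex_path_elem g) (ss_star (Some (\<gamma>, k, \<mu>))) \<noteq> None"
    using u(2) by (auto simp: below_def)
  then have r: "path_rng \<mu> = src \<Gamma> g"
    by (auto simp: vertex_path_elem_def path_prefix_Nil path_prefix_into_Nil path_rng_def split: if_splits)
  have \<mu>: "\<mu> \<in> paths E" using u by (simp add: carrier_S_GE)
  have "k = path_res g \<mu>"
    using below_vertex_path_elem[OF g(1) u(1) r u(2)] by simp
  moreover have "k = path_res (src \<Gamma> g) \<mu>"
    using below_vertex_path_elem[OF src_closed[OF g(1)] u(1) _ u(3)] r g by (simp add: src_src)
  moreover have "path_act g \<mu> = \<mu>"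
    using g(2) \<mu> r by (simp add: fixes_all_def mem_paths_with_range)
  ultimately show "\<exists>\<mu> \<in> paths_with_range (src \<Gamma> g). path_act g \<mu> = \<mu> \<and> path_res g \<mu> = path_src E \<mu>"
    using \<mu> r path_act_res_unit by (auto simp: mem_paths_with_range)
qed

lemma faithful_imp_fundamental:
  assumes faithful shows "fundamental S_GE"
  unfolding fundamental_def
proof (intro ballI impI)
  \<comment> \<open>Fundamentality also compares zero with other elements: a nonzero (\<gamma>, h,
    \<delta>) sends \<open>e\<^sub>\<delta>\<close> to \<open>e\<^sub>\<gamma>\<close>, whereas zero
    sends it to zero.\<close>
  have zero: "t = None" if t: "t \<in> carrier S_GE" and same: "same_conjugation S_GE None t" for t
  proof (rule ccontr)
    assume "t \<noteq> None"
    then obtain \<gamma> h \<delta> where "t = Some (\<gamma>, h, \<delta>)" by (auto simp: not_None_eq)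
    with t same conj_prefix[of \<gamma> h \<delta> \<delta>] show False
      by (auto simp: same_conjugation_iff carrier_S_GE)
  qed
  fix s t assume st: "s \<in> carrier S_GE" "t \<in> carrier S_GE" and same: "same_conjugation S_GE s t"
  then have sym: "same_conjugation S_GE t s" by (simp add: same_conjugation_def)
  show "s = t"
  proof (cases "s = None \<or> t = None")
    case True
    then show ?thesis using zero st same sym by auto
  next
    case False
    then obtain \<alpha> g \<beta> \<gamma> h \<delta> where s: "s = Some (\<alpha>, g, \<beta>)" and t: "t = Some (\<gamma>, h, \<delta>)"
    by (auto simp: not_None_eq)
    note c = st[unfolded s t carrier_S_GE]
    note e = same_conjugationE[OF st[unfolded s t] same[unfolded s t]]
    have gh: "g \<in> arrows \<Gamma>" "h \<in> arrows \<Gamma>" "rng \<Gamma> g = rng \<Gamma> h" "src \<Gamma> g = src \<Gamma> h"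
      using c e(1,2) by auto
    note q = fixes_all_quotient[OF gh e(3)]
    then have "ginv \<Gamma> h \<bullet> g \<in> units \<Gamma>" using assms faithful_iff by blast
    then have "ginv \<Gamma> h \<bullet> g = src \<Gamma> g" using q(2) units_iff by simp
    then show ?thesis using eq_if_ginv_comp_unit[OF gh(1-3)] s t e(1,2) by simp
  qed
qed

text \<open>Fundamentality identifies the elements built from \<open>g\<close> and from s(g); their
  middle entries then coincide.\<close>

lemma fundamental_imp_faithful:
  assumes "fundamental S_GE" shows faithful
  unfolding faithful_iff
proof (intro ballI impI)
  fix g assume g: "g \<in> arrows \<Gamma>" "fixes_all g"
  have "vertex_path_elem g = vertex_path_elem (src \<Gamma> g)"
    using assms[unfolded fundamental_def, rule_format, OF _ _ same_conjugation_vertex_path_elem[OF g]]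
      vertex_path_elem_in_carrier g src_closed by blast
  then have "g = src \<Gamma> g" by (simp add: vertex_path_elem_def)
  then show "g \<in> units \<Gamma>" using src_in_units[OF g(1)] by metis
qed

section \<open>Topological freeness of the two subsemigroups\<close>

lemma carrier_S0_GE:
  "Some (\<alpha>, g, \<beta>) \<in> carrier S0_GE \<longleftrightarrow> Some (\<alpha>, g, \<beta>) \<in> carrier S_GE \<and> path_length \<alpha> = path_length \<beta>"
  by (simp add: S0_GE_def)

lemma S0_S00_sel [simp]:
  "mult S0_GE = ss_mult" "star S0_GE = ss_star" "zero S0_GE = None"
  "mult S00_GE = ss_mult" "star S00_GE = ss_star" "zero S00_GE = None"
  "below S0_GE = below S_GE" "below S00_GE = below S_GE"
  by (simp_all add: S0_GE_def S00_GE_def below_def fun_eq_iff)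

lemma S00_subset_S0: "carrier S00_GE \<subseteq> carrier S0_GE"
  by (auto simp: S0_GE_def S00_GE_def carrier_S_GE path_act_res)

lemma S0_subset_S: "carrier S0_GE \<subseteq> carrier S_GE"
  by (auto simp: S0_GE_def S_GE_def)

text \<open>Take \<open>g\<close> to be the unit \<open>path_rng \<mu>\<close>, which fixes \<mu>
  and restricts to its source.\<close>

lemma path_idem_in_S00:
  assumes "\<mu> \<in> paths E" shows "path_idem \<mu> \<in> carrier S00_GE"
proof -
  have "path_rng \<mu> \<in> units \<Gamma>"
    using assms units_eq_verts by (auto simp: paths_def path_rng_def)
  then show ?thesis
    using mem_units[of "path_rng \<mu>"] path_act_res_unit[OF assms refl] assms
    unfolding S00_GE_def path_idem_def by (auto intro!: exI[of _ "path_rng \<mu>"])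
qed

text \<open>All idempotents of \<open>S_GE\<close> already lie in the smallest of the three nested
  carriers, and the product is the same in each.\<close>

lemma idempotents_sub:
  "idempotents S0_GE = idempotents S_GE" "idempotents S00_GE = idempotents S_GE"
proof -
  have *: "idempotents S_GE \<subseteq> carrier S00_GE"
    unfolding idempotents_S_GE using path_idem_in_S00 by (auto simp: S00_GE_def)
  then show "idempotents S0_GE = idempotents S_GE" "idempotents S00_GE = idempotents S_GE"
    using S00_subset_S0 S0_subset_S by (auto simp: idempotents_def)
qed

lemma idempotent_fixed_by_iff:
  "idempotent_fixed_by S_GE e t \<longleftrightarrow> (\<forall>\<mu> \<in> paths E. below S_GE (path_idem \<mu>) e \<longrightarrow>
     ss_mult (ss_mult (ss_mult t (path_idem \<mu>)) (ss_star t)) (path_idem \<mu>) \<noteq> None)"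
  by (auto simp: idempotent_fixed_by_def idempotents_S_GE)

lemma idempotent_fixed_by_sub:
  "idempotent_fixed_by S0_GE = idempotent_fixed_by S_GE"
  "idempotent_fixed_by S00_GE = idempotent_fixed_by S_GE"
  by (simp_all add: idempotent_fixed_by_def idempotents_sub fun_eq_iff)

lemma Evr_imp_S0_topologically_free:
  assumes Evr shows "topologically_free S0_GE"
  unfolding topologically_free_def idempotents_sub idempotent_fixed_by_sub S0_S00_sel
proof (intro ballI impI)
  fix t e assume t0: "t \<in> carrier S0_GE" and e0: "e \<in> idempotents S_GE"
    and f0: "e \<noteq> None \<and> idempotent_fixed_by S_GE e t"
  obtain \<gamma> where \<gamma>: "\<gamma> \<in> paths E" and e: "e = path_idem \<gamma>"
    using e0 f0 by (auto simp: idempotents_S_GE)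
  \<comment> \<open>Every extension \<gamma>\<nu> gives an idempotent below \<open>e\<close>, to
    which fixedness applies.\<close>
  have fixd: "ss_mult (ss_mult (ss_mult t (path_idem (path_append \<gamma> \<nu>))) (ss_star t)) (path_idem (path_append \<gamma> \<nu>)) \<noteq> None"
    if "\<nu> \<in> paths E" "path_rng \<nu> = path_src E \<gamma>" for \<nu>
    using f0 that below_path_idem_append[OF \<gamma>] paths_append \<gamma>
    unfolding e idempotent_fixed_by_iff by simp
  have fixd0: "ss_mult (ss_mult (ss_mult t (path_idem \<gamma>)) (ss_star t)) (path_idem \<gamma>) \<noteq> None"
    using fixd[of "(path_src E \<gamma>, [])"] \<gamma> by (simp add: path_rng_def path_src_in_verts)
  obtain \<alpha> g \<beta> where t: "t = Some (\<alpha>, g, \<beta>)"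
    using fixd0 by (cases t) auto
  have tc: "Some (\<alpha>, g, \<beta>) \<in> carrier S_GE" and len: "path_length \<alpha> = path_length \<beta>"
    using t0 by (auto simp: t carrier_S0_GE)
  note c = tc[unfolded carrier_S_GE]
  have "path_prefix \<beta> \<gamma> \<or> path_prefix \<gamma> \<beta>"
    using fixd0 conj_incomparable[of \<beta> \<gamma> \<alpha> g] unfolding t by (metis ss_mult.simps(2))
  \<comment> \<open>the longer of \<open>\<beta>\<close> and \<open>\<gamma>\<close>\<close>
  then obtain \<beta>' \<gamma>' where l: "path_append \<beta> \<beta>' = path_append \<gamma> \<gamma>'"
    and \<beta>': "\<beta>' \<in> paths E" "path_rng \<beta>' = path_src E \<beta>"
    and \<gamma>': "\<gamma>' \<in> paths E" "path_rng \<gamma>' = path_src E \<gamma>"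
  proof
    assume "path_prefix \<beta> \<gamma>"
    then obtain \<nu> where "\<gamma> = path_append \<beta> \<nu>" "\<nu> \<in> paths E" "path_rng \<nu> = path_src E \<beta>"
      using path_prefixE \<gamma> by metis
    then show thesis
      using that[of \<nu> "(path_src E \<gamma>, [])"] \<gamma> by (simp add: path_rng_def path_src_in_verts)
  next
    assume "path_prefix \<gamma> \<beta>"
    then obtain \<nu> where "\<beta> = path_append \<gamma> \<nu>" "\<nu> \<in> paths E" "path_rng \<nu> = path_src E \<gamma>"
      using path_prefixE c by metis
    then show thesis
      using that[of "(path_src E \<beta>, [])" \<nu>] c by (simp add: path_rng_def path_src_in_verts)
  qed
  have src_eq: "path_src E \<beta>' = path_src E \<gamma>'"
    using arg_cong[OF l, of "path_src E"] \<beta>' \<gamma>' by simp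
  have rb: "path_rng \<beta>' = src \<Gamma> g" using c \<beta>' by simp
  have gc: "g \<in> arrows \<Gamma>" using c by simp
  let ?k = "path_res g \<beta>'"
  note k = path_act_res[OF gc \<beta>'(1) rb] and ap = path_act_res_append[of g \<beta>']
  \<comment> \<open>Extend the common path \<beta>\<beta>' = \<gamma>\<gamma>' by \<mu>. Fixedness
    makes \<alpha>(g(\<beta>'\<mu>)) and \<beta>\<beta>'\<mu> comparable; |\<alpha>| = |\<beta>|
    makes them equally long, hence equal.\<close>
  have main: "\<alpha> = \<beta>" "path_act g (path_append \<beta>' \<mu>) = path_append \<beta>' \<mu>"
    if \<mu>: "\<mu> \<in> paths E" "path_rng \<mu> = path_src E \<beta>'" for \<mu>
  proof -
    have p: "path_append \<beta>' \<mu> \<in> paths E" "path_rng (path_append \<beta>' \<mu>) = path_src E \<beta>"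
      "path_append \<gamma>' \<mu> \<in> paths E" "path_rng (path_append \<gamma>' \<mu>) = path_src E \<gamma>"
      using \<mu> \<beta>' \<gamma>' src_eq paths_append by auto
    have l': "path_append \<gamma> (path_append \<gamma>' \<mu>) = path_append \<beta> (path_append \<beta>' \<mu>)"
      using l path_append_assoc by metis
    have "ss_mult (path_idem (path_append \<alpha> (path_act g (path_append \<beta>' \<mu>))))
        (path_idem (path_append \<beta> (path_append \<beta>' \<mu>))) \<noteq> None"
      using fixd[OF p(3,4)] conj_append[OF tc p(1,2)] unfolding l' t by simp
    then have eq: "path_append \<alpha> (path_act g (path_append \<beta>' \<mu>)) = path_append \<beta> (path_append \<beta>' \<mu>)"
      unfolding path_idem_mult_ne_iff using len by (intro path_prefix_same_length) auto
    then show ab: "\<alpha> = \<beta>" using len by (rule path_append_eq_same_length)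
    have "path_rng (path_act g (path_append \<beta>' \<mu>)) = path_rng (path_append \<beta>' \<mu>)"
      using path_act_res(2)[OF gc p(1)] p(2) c ab by simp
    with eq show "path_act g (path_append \<beta>' \<mu>) = path_append \<beta>' \<mu>"
      unfolding ab by (rule path_append_cancel)
  qed
  \<comment> \<open>Extending by the vertex s(\<beta>') extracts \<alpha> = \<beta> and g\<beta>' =
    \<beta>'.\<close>
  have vb: "(path_src E \<beta>', []) \<in> paths E" using \<beta>' by (simp add: path_src_in_verts)
  have ab: "\<alpha> = \<beta>" and gb: "path_act g \<beta>' = \<beta>'"
    using main[OF vb] by (simp_all add: path_rng_def)
  have "fixes_all ?k"
    unfolding fixes_all_def mem_paths_with_range k(4)
  proof (intro ballI)
    fix \<mu> assume \<mu>: "\<mu> \<in> paths_with_range (path_src E \<beta>')"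
    then have \<mu>: "\<mu> \<in> paths E" "path_rng \<mu> = path_src E \<beta>'" by (auto simp: mem_paths_with_range)
    \<comment> \<open>g(\<beta>'\<mu>) is g\<beta>' = \<beta>' followed by the action of
      \<open>?k\<close> on \<mu>.\<close>
    have "path_append \<beta>' (path_act ?k \<mu>) = path_append \<beta>' \<mu>"
      using main(2)[OF \<mu>] ap gb by simp
    moreover have "path_rng (path_act ?k \<mu>) = path_rng \<mu>"
      using path_act_res(2)[OF k(3) \<mu>(1)] \<mu> k gb by simp
    ultimately show "path_act ?k \<mu> = \<mu>" by (rule path_append_cancel)
  qed
  then obtain \<mu> where \<mu>: "\<mu> \<in> paths E" "path_rng \<mu> = path_src E \<beta>'"
    "path_act ?k \<mu> = \<mu>" "path_res ?k \<mu> = path_src E \<mu>"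
    using assms k Evr_iff mem_paths_with_range by metis
  \<comment> \<open>The path \<beta>\<beta>'\<mu> serves twice: \<open>g\<close> strongly fixes
    \<beta>'\<mu>, which puts its idempotent below \<open>t\<close>, and it extends \<gamma>, so the
    product with \<open>e\<close> is nonzero.\<close>
  let ?\<nu> = "path_append \<beta>' \<mu>" let ?\<delta> = "path_append \<beta> ?\<nu>"
  have \<nu>: "?\<nu> \<in> paths E" "path_rng ?\<nu> = path_src E \<beta>" using \<mu> \<beta>' paths_append by auto
  then have \<delta>: "?\<delta> \<in> paths E" using c paths_append by simp
  have "below S_GE (path_idem ?\<delta>) t"
    using below_append_iff[OF tc _ \<nu>(2), of ?\<delta> "path_src E ?\<delta>"] path_idem_in_carrier[OF \<delta>]
      main(2)[OF \<mu>(1,2)] ab ap \<mu> \<nu>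
    by (simp add: t path_idem_def)
  moreover have "ss_mult (path_idem ?\<delta>) e \<noteq> None"
  proof -
    have "?\<delta> = path_append \<gamma> (path_append \<gamma>' \<mu>)" using l path_append_assoc by metis
    then show ?thesis unfolding e path_idem_mult_ne_iff by simp
  qed
  ultimately show "\<exists>f \<in> idempotents S_GE. f \<noteq> None \<and> below S_GE f t \<and> ss_mult f e \<noteq> None"
    using \<delta> by (intro bexI[of _ "path_idem ?\<delta>"]) (auto simp: idempotents_S_GE)
qed

text \<open>Idempotents, order and fixedness agree in both, so the condition is merely tested on
  fewer elements.\<close>

lemma S0_topologically_free_imp_S00:
  "topologically_free S0_GE \<Longrightarrow> topologically_free S00_GE"
  using S00_subset_S0
  by (auto simp: topologically_free_def idempotents_sub idempotent_fixed_by_sub)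

lemma S00_topologically_free_imp_Evr:
  assumes "topologically_free S00_GE" shows Evr
  unfolding Evr_iff
proof (intro ballI impI)
  fix g assume g: "g \<in> arrows \<Gamma>" "fixes_all g"
  let ?t = "vertex_path_elem g" let ?v = "(src \<Gamma> g, [])"
  have v: "?v \<in> paths E" using src_in_units[OF g(1)] by (simp add: units_eq_verts)
  \<comment> \<open>Here \<beta> is the vertex s(g), whose image is r(g) and along which
    \<open>g\<close> restricts to itself.\<close>
  have t: "?t \<in> carrier S00_GE"
    using g v unfolding S00_GE_def vertex_path_elem_def
    by (auto intro!: exI[of _ g] simp: path_rng_def)
  \<comment> \<open>Every nonzero idempotent below \<open>e\<close> at s(g) is conjugated to
    itself.\<close>
  have "idempotent_fixed_by S_GE (path_idem ?v) ?t"
    unfolding idempotent_fixed_by_iff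
  proof (intro ballI impI)
    fix \<mu> assume \<mu>: "\<mu> \<in> paths E" "below S_GE (path_idem \<mu>) (path_idem ?v)"
    have "ss_mult (ss_mult ?t (path_idem \<mu>)) (ss_star ?t) = path_idem \<mu>"
      using vertex_path_elem_conj[OF g \<mu>(1)] below_path_idem_range[OF \<mu>] by simp
    then show "ss_mult (ss_mult (ss_mult ?t (path_idem \<mu>)) (ss_star ?t)) (path_idem \<mu>) \<noteq> None"
      using path_idem_mult_ne_iff[of \<mu> \<mu>] by simp
  qed
  then have "\<exists>f \<in> idempotents S_GE. f \<noteq> None \<and> below S_GE f ?t \<and> ss_mult f (path_idem ?v) \<noteq> None"
    using assms t v
    by (auto simp: topologically_free_def idempotents_sub idempotent_fixed_by_sub idempotents_S_GE
       )
  then obtain \<mu> where \<mu>: "\<mu> \<in> paths E" "below S_GE (path_idem \<mu>) ?t"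
    "ss_mult (path_idem \<mu>) (path_idem ?v) \<noteq> None"
    by (auto simp: idempotents_S_GE)
  have r: "path_rng \<mu> = src \<Gamma> g"
    using \<mu>(3) unfolding path_idem_mult_ne_iff path_prefix_Nil path_prefix_into_Nil
    by (auto simp: path_rng_def)
  \<comment> \<open>An idempotent has equal outer paths and a unit in the middle, so lying below
    \<open>?t\<close> is strong fixing of \<mu>.\<close>
  have "path_act g \<mu> = \<mu>" "path_res g \<mu> = path_src E \<mu>"
    using below_vertex_path_elem[OF g(1) path_idem_in_carrier[OF \<mu>(1), unfolded path_idem_def] r
        \<mu>(2)[unfolded path_idem_def]] by (metis, metis)
  then show "\<exists>\<mu> \<in> paths_with_range (src \<Gamma> g). path_act g \<mu> = \<mu> \<and> path_res g \<mu> = path_src E \<mu>"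
    using \<mu>(1) r by (auto simp: mem_paths_with_range)
qed

end

theorem proposition5p15:
  fixes \<Gamma> :: "'g groupoid_data" and E :: "('g, 'e) pre_digraph"
    and act :: "'g \<Rightarrow> 'e \<Rightarrow> 'e" and res :: "'g \<Rightarrow> 'e \<Rightarrow> 'g"
  assumes "self_similar_action \<Gamma> E act res"
  shows "(self_similar_action.Evr \<Gamma> E act res \<longleftrightarrow>
            quasi_fundamental (self_similar_action.S_GE \<Gamma> E act res)) \<and>
         (self_similar_action.Evr \<Gamma> E act res \<longleftrightarrow>
            topologically_free (self_similar_action.S0_GE \<Gamma> E act res)) \<and>
         (self_similar_action.Evr \<Gamma> E act res \<longleftrightarrow>
            topologically_free (self_similar_action.S00_GE \<Gamma> E act res)) \<and>
         (fundamental (self_similar_action.S_GE \<Gamma> E act res) \<longleftrightarrow>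
            self_similar_action.faithful \<Gamma> E act res)"
proof -
  interpret self_similar_action \<Gamma> E act res by (fact assms)
  \<comment> \<open>The conditions on \<open>S0_GE\<close> and \<open>S00_GE\<close> are joined to
    \<open>Evr\<close> in a cycle of three implications.\<close>
  show ?thesis
    using Evr_imp_quasi_fundamental quasi_fundamental_imp_Evr Evr_imp_S0_topologically_free
      S0_topologically_free_imp_S00 S00_topologically_free_imp_Evr
      faithful_imp_fundamental fundamental_imp_faithful
    by blast
qed

end
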